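(* Let $A:S^\ell\to[0,\infty)$ be a function such that for every $(a_1,\dots,a_{\ell-1})\in S^{\ell-1}$ there exists at least one $j\in S$ with $A(a_1,\dots,a_{\ell-1},j)>0$. Then the operator $\mathcal{N}$ associated with $A$ has a unique positive fixed point, i.e. there is exactly one function $y:S^{\ell-1}\to[0,\infty)$ with $y(a)>0$ for all $a\in S^{\ell-1}$ and $\mathcal{N}y=y$.
   Context: Let $m\ge2$, $\ell\ge2$, $q\ge2$ be integers and $S=\{0,1,\dots,m-1\}$. The (non-linear) operator $\mathcal{N}$ acts on functions $y:S^{\ell-1}\to[0,\infty)$ by $$\mathcal{N}y(a_1,a_2,\dots,a_{\ell-1})=\Big(\sum_{j\in S}A(a_1,a_2,\dots,a_{\ell-1},j)\,y(a_2,\dots,a_{\ell-1},j)\Big)^{1/q}.$$ *)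

theory Defs
  imports Complex_Main "HOL-Library.FuncSet" "HOL-Library.NList"
begin

text \<open>
  The set \<open>S = {0,\<dots>,m-1}\<close> is \<open>{..<m}\<close>, and \<open>S\<^sup>n\<close> is the set \<open>nlists n {..<m}\<close> of lists.
  Functions on \<open>S\<^sup>n\<close> are represented extensionally (they are \<open>undefined\<close> off
  \<open>S\<^sup>n\<close>), so that equality of functions is equality on \<open>S\<^sup>n\<close>; this is why
  the operator below ends in a restriction. For \<open>a = [a\<^sub>1,\<dots>,a\<^sub>l\<^sub>-\<^sub>1]\<close>, the list
  \<open>tl a @ [j]\<close> is \<open>[a\<^sub>2,\<dots>,a\<^sub>l\<^sub>-\<^sub>1,j]\<close>.
\<close>

definition nonlinear_op ::
  "nat \<Rightarrow> nat \<Rightarrow> nat \<Rightarrow> (nat list \<Rightarrow> real) \<Rightarrow> (nat list \<Rightarrow> real) \<Rightarrow> nat list \<Rightarrow> real" where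
  "nonlinear_op m l q A y =
     (\<lambda>a\<in>nlists (l - 1) {..<m}.
        (\<Sum>j<m. A (a @ [j]) * y (tl a @ [j])) powr (1 / real q))"

end

theory Submission
  imports Defs
begin

text \<open>
  The operator has the form
  \<open>F y x = (\<Sum>j\<in>J. w x j * y (s x j)) powr p\<close> with weights \<open>w \<ge> 0\<close> that do not all vanish
  in any row \<open>x\<close>, and with an exponent \<open>p = 1/q\<close> in \<open>(0,1)\<close>. It is therefore monotone and
  homogeneous of degree \<open>p < 1\<close>: scaling the argument by \<open>K\<close> scales the value only by
  \<open>K powr p\<close>, which is closer to \<open>1\<close>.

  Uniqueness: if \<open>y\<close>, \<open>z\<close> are positive fixed points and \<open>K\<close> is the least constant with
  \<open>z \<le> K y\<close>, then \<open>z = F z \<le> F (K y) = (K powr p) y\<close>, hence \<open>K \<le> K powr p\<close>,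
  because \<open>z = K y\<close> somewhere, hence \<open>K \<le> 1\<close> (lemma \<open>fixed_point_le\<close>); exchange \<open>y\<close> and \<open>z\<close>.

  Existence: sublinearity makes every sufficiently small constant a sub-solution and every
  sufficiently large constant a super-solution (lemma \<open>constant_sub_super_solutions\<close>). The iterates of
  \<open>F\<close> that start at a small constant \<open>c > 0\<close> thus increase, stay below a large constant, and
  converge; by continuity the limit is a fixed point, positive since it is at least \<open>c\<close>.
\<close>

text \<open>
  The \<open>j\<close>-th arrow out of the state \<open>x\<close> leads to \<open>s x j\<close> and carries the weight \<open>w x j\<close>.
  Several arrows may lead to the same state.
\<close>

locale sublinear_system =
  fixes X :: "'x set" and J :: "'j set" and w :: "'x \<Rightarrow> 'j \<Rightarrow> real" and s :: "'x \<Rightarrow> 'j \<Rightarrow> 'x"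
    and p :: real
  assumes finite_X: "finite X" and finite_J: "finite J"
    and s_in: "\<lbrakk>x \<in> X; j \<in> J\<rbrakk> \<Longrightarrow> s x j \<in> X"
    and w_nonneg: "\<lbrakk>x \<in> X; j \<in> J\<rbrakk> \<Longrightarrow> 0 \<le> w x j"
    and w_pos: "x \<in> X \<Longrightarrow> \<exists>j\<in>J. 0 < w x j"
    and p_pos: "0 < p" and p_less_1: "p < 1"
begin

definition weighted_sum :: "('x \<Rightarrow> real) \<Rightarrow> 'x \<Rightarrow> real" where
  "weighted_sum y x = (\<Sum>j\<in>J. w x j * y (s x j))"

definition F :: "('x \<Rightarrow> real) \<Rightarrow> 'x \<Rightarrow> real" where
  "F y x = weighted_sum y x powr p"

lemma weighted_sum_nonneg:
  assumes "x \<in> X" and "\<And>x. x \<in> X \<Longrightarrow> 0 \<le> y x"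
  shows "0 \<le> weighted_sum y x"
  unfolding weighted_sum_def using assms s_in w_nonneg by (auto intro!: sum_nonneg mult_nonneg_nonneg)

lemma weighted_sum_pos:
  assumes x: "x \<in> X" and y: "\<And>x. x \<in> X \<Longrightarrow> 0 < y x"
  shows "0 < weighted_sum y x"
proof -
  obtain j where "j \<in> J" "0 < w x j"
    using w_pos[OF x] by blast
  then show ?thesis
    unfolding weighted_sum_def
    using x y s_in w_nonneg finite_J
    by (intro sum_pos2[where i = j]) (auto intro!: mult_nonneg_nonneg less_imp_le[OF y])
qed

lemma F_mono:
  assumes x: "x \<in> X" and "\<And>x. x \<in> X \<Longrightarrow> 0 \<le> y x" and "\<And>x. x \<in> X \<Longrightarrow> y x \<le> z x"
  shows "F y x \<le> F z x"
proof -
  have "weighted_sum y x \<le> weighted_sum z x"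
    unfolding weighted_sum_def using assms s_in w_nonneg by (intro sum_mono mult_left_mono) auto
  then show ?thesis
    unfolding F_def using weighted_sum_nonneg[OF x] assms(2) p_pos by (intro powr_mono2) auto
qed

lemma F_scale: "F (\<lambda>x. K * y x) x = K powr p * F y x"
  if "0 \<le> K" "x \<in> X" "\<And>x. x \<in> X \<Longrightarrow> 0 \<le> y x"
proof -
  have "weighted_sum (\<lambda>x. K * y x) x = K * weighted_sum y x"
    by (simp add: weighted_sum_def sum_distrib_left algebra_simps)
  then show ?thesis
    using that weighted_sum_nonneg[of x y] by (simp add: F_def powr_mult)
qed

text \<open>
  The largest ratio \<open>K\<close> of \<open>z\<close> to \<open>y\<close> satisfies \<open>K \<le> K powr p\<close>, which forces
  \<open>K \<le> 1\<close> because \<open>p < 1\<close>: at a state where the ratio is attained, applying \<open>F\<close> to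
  \<open>z \<le> K y\<close> bounds that same ratio by \<open>K powr p\<close>.
\<close>

lemma fixed_point_le:
  assumes y: "\<And>x. x \<in> X \<Longrightarrow> 0 < y x" "\<And>x. x \<in> X \<Longrightarrow> F y x = y x"
    and z: "\<And>x. x \<in> X \<Longrightarrow> 0 < z x" "\<And>x. x \<in> X \<Longrightarrow> F z x = z x"
    and x: "x \<in> X"
  shows "z x \<le> y x"
proof -
  define K where "K = Max ((\<lambda>x. z x / y x) ` X)"
  have bound: "z a \<le> K * y a" if "a \<in> X" for a
  proof -
    have "z a / y a \<le> K"
      unfolding K_def using finite_X that by (intro Max_ge) auto
    then show ?thesis
      using y(1)[OF that] by (simp add: pos_divide_le_eq)
  qed
  have "K \<in> (\<lambda>x. z x / y x) ` X"
    unfolding K_def using finite_X x by (intro Max_in) auto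
  then obtain b where b: "b \<in> X" "K = z b / y b"
    by blast
  have "0 < K"
    using b y(1) z(1) by simp
  have "z b = F z b"
    using z(2) b(1) by simp
  also have "\<dots> \<le> F (\<lambda>x. K * y x) b"
    using b(1) bound z(1) by (intro F_mono) (auto intro: less_imp_le)
  also have "\<dots> = K powr p * y b"
    using F_scale[of K b y] y b(1) \<open>0 < K\<close> by (simp add: less_imp_le)
  finally have "K \<le> K powr p"
    using b y(1)[OF b(1)] by (simp add: pos_divide_le_eq)
  have "K \<le> 1"
  proof (rule ccontr)
    assume "\<not> K \<le> 1"
    then have "K powr p < K powr 1"
      using p_less_1 by (intro powr_less_mono) auto
    with \<open>K \<le> K powr p\<close> \<open>0 < K\<close> show False
      by simp
  qed
  then have "K * y x \<le> 1 * y x"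
    using y(1)[OF x] by (intro mult_right_mono) auto
  with bound[OF x] show ?thesis
    by simp
qed

text \<open>
  If all rows had the same weight sum \<open>t\<close>, the constant function with this value would be a
  fixed point: it solves \<open>c = (c * t) powr p\<close>. For unequal rows, a lower and an upper bound of
  the weight sums give a constant sub-solution and a constant super-solution.
\<close>

lemma constant_balance:
  assumes "0 < t"
  shows "(t powr (p / (1 - p)) * t) powr p = t powr (p / (1 - p))"
proof -
  have "t powr (p / (1 - p)) * t = t powr (p / (1 - p) + 1)"
    using assms by (simp add: powr_add)
  moreover have "(p / (1 - p) + 1) * p = p / (1 - p)"
    using p_less_1 by (simp add: field_simps)
  ultimately show ?thesis
    by (simp add: powr_powr)
qed

lemma weighted_sum_const: "weighted_sum (\<lambda>_. c) x = c * weighted_sum (\<lambda>_. 1) x"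
  by (simp add: weighted_sum_def sum_distrib_left mult.commute)

lemma constant_sub_super_solutions:
  obtains c C where "0 < c" and "c \<le> C"
    and "\<And>x. x \<in> X \<Longrightarrow> c \<le> F (\<lambda>_. c) x" and "\<And>x. x \<in> X \<Longrightarrow> F (\<lambda>_. C) x \<le> C"
proof
  let ?r = "weighted_sum (\<lambda>_. 1)"
  (* The element 1 keeps both extrema meaningful when X is empty, and ensures lo <= hi. *)
  define lo where "lo = Min (insert 1 (?r ` X))"
  define hi where "hi = Max (insert 1 (?r ` X))"
  define c where "c = lo powr (p / (1 - p))"
  define C where "C = hi powr (p / (1 - p))"
  have r_pos: "0 < ?r x" if "x \<in> X" for x
    using that by (intro weighted_sum_pos) auto
  have lo_pos: "0 < lo"
    unfolding lo_def using finite_X r_pos by (subst Min_gr_iff) auto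
  have "lo \<le> 1" "1 \<le> hi"
    unfolding lo_def hi_def using finite_X by auto
  then have "lo \<le> hi" "0 < hi"
    by auto
  have r_bounds: "lo \<le> ?r x" "?r x \<le> hi" if "x \<in> X" for x
    unfolding lo_def hi_def using finite_X that by auto
  show "0 < c"
    using lo_pos by (simp add: c_def)
  show "c \<le> C"
    unfolding c_def C_def using lo_pos \<open>lo \<le> hi\<close> p_pos p_less_1 by (intro powr_mono2) auto
  show "c \<le> F (\<lambda>_. c) x" if "x \<in> X" for x
  proof -
    have "c = (c * lo) powr p"
      unfolding c_def using constant_balance[OF lo_pos] by simp
    also have "\<dots> \<le> (c * ?r x) powr p"
      using r_bounds[OF that] lo_pos \<open>0 < c\<close> p_pos by (intro powr_mono2 mult_left_mono) auto
    finally show ?thesis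
      by (simp add: F_def weighted_sum_const[of c])
  qed
  show "F (\<lambda>_. C) x \<le> C" if "x \<in> X" for x
  proof -
    have "0 < C"
      using \<open>0 < hi\<close> by (simp add: C_def)
    have "F (\<lambda>_. C) x = (C * ?r x) powr p"
      by (simp add: F_def weighted_sum_const[of C])
    also have "\<dots> \<le> (C * hi) powr p"
      using r_bounds[OF that] r_pos[OF that] \<open>0 < C\<close> p_pos
      by (intro powr_mono2 mult_left_mono) auto
    also have "\<dots> = C"
      unfolding C_def using constant_balance[OF \<open>0 < hi\<close>] by simp
    finally show ?thesis .
  qed
qed

text \<open>
  Monotone iteration from the sub-solution. Positivity of the limit also serves continuity: the
  map \<open>\<lambda>r. r powr p\<close> is applied to a positive limit.
\<close>

lemma positive_fixed_point_exists:
  obtains y where "\<And>x. x \<in> X \<Longrightarrow> 0 < y x" and "\<And>x. x \<in> X \<Longrightarrow> F y x = y x"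
proof -
  obtain c C where c: "0 < c" "c \<le> C" "\<And>x. x \<in> X \<Longrightarrow> c \<le> F (\<lambda>_. c) x"
    and C: "\<And>x. x \<in> X \<Longrightarrow> F (\<lambda>_. C) x \<le> C"
    using constant_sub_super_solutions by blast
  define u where "u n = (F ^^ n) (\<lambda>_. c)" for n
  have u_Suc: "u (Suc n) = F (u n)" for n
    by (simp add: u_def)
  have u_bounds: "c \<le> u n x \<and> u n x \<le> C" if "x \<in> X" for n x
    using that
  proof (induction n arbitrary: x)
    case 0
    then show ?case
      using c by (simp add: u_def)
  next
    case (Suc n)
    have pos: "0 \<le> u n a" if "a \<in> X" for a
      using Suc.IH[OF that] c(1) by linarith
    have "c \<le> F (\<lambda>_. c) x"
      using c(3) Suc.prems .
    also have "\<dots> \<le> F (u n) x"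
      using Suc c(1) by (intro F_mono) auto
    finally have "c \<le> F (u n) x" .
    moreover have "F (u n) x \<le> F (\<lambda>_. C) x"
      using Suc pos by (intro F_mono) auto
    ultimately show ?case
      using C[OF Suc.prems] by (simp add: u_Suc)
  qed
  have u_nonneg: "0 \<le> u n x" if "x \<in> X" for n x
    using u_bounds[OF that, of n] c(1) by linarith
  have u_incr: "u n x \<le> u (Suc n) x" if "x \<in> X" for n x
    using that
  proof (induction n arbitrary: x)
    case 0
    then show ?case
      using c(3) by (simp add: u_def)
  next
    case (Suc n)
    have "F (u n) x \<le> F (u (Suc n)) x"
      using Suc u_nonneg by (intro F_mono) auto
    then show ?case
      by (simp add: u_Suc)
  qed
  define y where "y x = lim (\<lambda>n. u n x)" for x
  have u_lim: "(\<lambda>n. u n x) \<longlonglongrightarrow> y x" if x: "x \<in> X" for x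
  proof -
    have "incseq (\<lambda>n. u n x)"
      using u_incr[OF x] by (intro incseq_SucI)
    then obtain L where "(\<lambda>n. u n x) \<longlonglongrightarrow> L"
      using incseq_convergent[of "\<lambda>n. u n x" C] u_bounds[OF x] by blast
    then show ?thesis
      unfolding y_def by (simp add: limI)
  qed
  have y_pos: "0 < y x" if "x \<in> X" for x
    using LIMSEQ_le_const[OF u_lim[OF that], of c] u_bounds[OF that] c(1) by auto
  have "F y x = y x" if x: "x \<in> X" for x
  proof -
    have "(\<lambda>n. weighted_sum (u n) x) \<longlonglongrightarrow> weighted_sum y x"
      unfolding weighted_sum_def
      using u_lim s_in[OF x] by (intro tendsto_sum tendsto_mult_left) auto
    then have "(\<lambda>n. F (u n) x) \<longlonglongrightarrow> F y x"
      unfolding F_def using weighted_sum_pos[of x y] x y_pos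
      by (intro tendsto_powr tendsto_const) auto
    moreover have "(\<lambda>n. F (u n) x) \<longlonglongrightarrow> y x"
      using LIMSEQ_Suc[OF u_lim[OF x]] by (simp add: u_Suc)
    ultimately show ?thesis
      by (rule LIMSEQ_unique)
  qed
  with y_pos that show thesis
    by blast
qed

text \<open>Extensionality turns uniqueness of the values on \<open>X\<close> into uniqueness of the function.\<close>

theorem ex1_positive_fixed_point:
  "\<exists>!y. y \<in> X \<rightarrow>\<^sub>E {0..} \<and> (\<forall>x\<in>X. 0 < y x) \<and> restrict (F y) X = y"
proof -
  obtain y where y: "\<And>x. x \<in> X \<Longrightarrow> 0 < y x" "\<And>x. x \<in> X \<Longrightarrow> F y x = y x"
    using positive_fixed_point_exists by blast
  have F_restrict: "F (restrict y X) x = F y x" if "x \<in> X" for x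
    unfolding F_def weighted_sum_def using s_in[OF that] by simp
  show ?thesis
  proof (rule ex1I[of _ "restrict y X"])
    show "restrict y X \<in> X \<rightarrow>\<^sub>E {0..} \<and> (\<forall>x\<in>X. 0 < restrict y X x) \<and>
        restrict (F (restrict y X)) X = restrict y X"
      using y F_restrict by (auto intro: less_imp_le intro!: restrict_ext)
  next
    fix z
    assume z: "z \<in> X \<rightarrow>\<^sub>E {0..} \<and> (\<forall>x\<in>X. 0 < z x) \<and> restrict (F z) X = z"
    then have fixed: "F z x = z x" if "x \<in> X" for x
    proof -
      have "restrict (F z) X x = z x"
        using z by simp
      then show ?thesis
        using that by simp
    qed
    have z_pos: "0 < z x" if "x \<in> X" for x
      using z that by blast
    have "z x = y x" if "x \<in> X" for x
      using fixed_point_le[OF y z_pos fixed that] fixed_point_le[OF z_pos fixed y that]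
      by (rule order.antisym)
    then have "restrict z X = restrict y X"
      by (rule restrict_ext)
    moreover have "restrict z X = z"
      using z by (auto intro: extensional_restrict simp: PiE_def)
    ultimately show "z = restrict y X"
      by simp
  qed
qed

end

text \<open>
  The states are the words of length \<open>l - 1\<close> over \<open>{..<m}\<close>, and the arrow \<open>j\<close> shifts the
  letter \<open>j\<close> in from the right.
\<close>

theorem theorem4p1:
  fixes m l q :: nat and A :: "nat list \<Rightarrow> real"
  assumes "m \<ge> 2" and "l \<ge> 2" and "q \<ge> 2"
    and "A \<in> nlists l {..<m} \<rightarrow> {0..}"
    and "\<forall>a\<in>nlists (l - 1) {..<m}. \<exists>j<m. A (a @ [j]) > 0"
  shows "\<exists>!y. y \<in> nlists (l - 1) {..<m} \<rightarrow>\<^sub>E {0..} \<and>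
           (\<forall>a\<in>nlists (l - 1) {..<m}. y a > 0) \<and>
           nonlinear_op m l q A y = y"
proof -
  let ?X = "nlists (l - 1) {..<m}"
  interpret sublinear_system ?X "{..<m}" "\<lambda>a j. A (a @ [j])" "\<lambda>a j. tl a @ [j]" "1 / real q"
  proof
    have "?X = {a. set a \<subseteq> {..<m} \<and> length a = l - 1}"
      unfolding nlists_def by (rule Collect_cong) blast
    then show "finite ?X"
      by (simp add: finite_lists_length_eq)
    show "finite {..<m}"
      by simp
  next
    fix a j
    assume a: "a \<in> ?X" and j: "j \<in> {..<m}"
    then have len: "length a = l - 1" and letters: "set a \<subseteq> {..<m}"
      by simp_all
    then have "set (tl a) \<subseteq> {..<m}"
      by (cases a) simp_all
    with len j \<open>l \<ge> 2\<close> show "tl a @ [j] \<in> ?X"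
      by (intro nlistsI) simp_all
    have "a @ [j] \<in> nlists l {..<m}"
      using len letters j \<open>l \<ge> 2\<close> by (intro nlistsI) simp_all
    then show "0 \<le> A (a @ [j])"
      using assms(4) by (simp add: Pi_iff)
  next
    fix a
    assume "a \<in> ?X"
    then show "\<exists>j\<in>{..<m}. 0 < A (a @ [j])"
      using assms(5) by blast
  next
    show "0 < 1 / real q" and "1 / real q < 1"
      using \<open>q \<ge> 2\<close> by simp_all
  qed
  have "nonlinear_op m l q A y = restrict (F y) ?X" for y
    unfolding nonlinear_op_def by (intro restrict_ext) (simp add: F_def weighted_sum_def)
  then show ?thesis
    using ex1_positive_fixed_point by simp
qed

end
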